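(* (i) The class (I, II) of generalized triplets consists of the triplets of odd primes, with $D_1$ odd and $D_2$ even (positive, $3\nmid D_2$), $$p_i=2a-D_1,\quad p_m=2a+D_1=3(2b-1)-D_2,\quad p_f=3(2b-1)+D_2$$ with integers $a,b$ subject to $a=3b-\frac12(D_1+D_2+3)$. Hence $p_f=2a+D_1+2D_2$, and the prime pair consisting of $p_f=2a+D_2+(D_1+D_2)$ and $p_i=2a+D_2-(D_1+D_2)$ is in class I. (ii) If moreover $D_1\equiv 2r_1+1\pmod 6$ with $r_1\in\{0,1,-1\}$, $D_2\equiv 2r_2\pmod 6$ with $r_2\in\{1,-1\}$, and $a\equiv a_0\pmod 3$ with $a_0\in\{0,1,-1\}$, then $$p_i\equiv -2r_1-1+2a_0,\quad p_m\equiv 2r_1+1+2a_0\equiv -3-2r_2,\quad p_f\equiv -3+2r_2\pmod 6.$$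
   Context: A generalized triplet is a triple of odd primes $p_i<p_m<p_f$ with $p_m-p_i=2D_1$, $p_f-p_m=2D_2$. For a pair of odd primes $p<p'$ with $p'-p=2D$, the classes are, with $a$ an integer: class I: $D$ odd, $p=2a-D$, $p'=2a+D$; class II: $2\mid D$, $3\nmid D$, $p=3(2a-1)-D$, $p'=3(2a-1)+D$; class III: $6\mid D$, $D\ge 6$, $p=2a+1-D$, $p'=2a+1+D$. A triplet is in class $(X,Y)$ if $(p_i,p_m)$ is in class $X$ and $(p_m,p_f)$ is in class $Y$. *)

theory Defs
  imports "HOL-Number_Theory.Cong" "HOL-Computational_Algebra.Primes" Complex_Main
begin

text \<open>All numbers are integers; \<open>prime\<close> on \<open>int\<close> entails positivity.
  The half-gap \<open>D\<close> of a pair is an explicit argument, determined by \<open>p' - p = 2 * D\<close>.\<close>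

definition odd_prime :: "int \<Rightarrow> bool" where
  "odd_prime p \<longleftrightarrow> prime p \<and> odd p"

definition odd_prime_pair :: "int \<Rightarrow> int \<Rightarrow> int \<Rightarrow> bool" where
  "odd_prime_pair D p p' \<longleftrightarrow> odd_prime p \<and> odd_prime p' \<and> p < p' \<and> p' - p = 2 * D"

definition generalized_triplet :: "int \<Rightarrow> int \<Rightarrow> int \<Rightarrow> int \<Rightarrow> int \<Rightarrow> bool" where
  "generalized_triplet D\<^sub>1 D\<^sub>2 p\<^sub>i p\<^sub>m p\<^sub>f \<longleftrightarrow>
     odd_prime p\<^sub>i \<and> odd_prime p\<^sub>m \<and> odd_prime p\<^sub>f \<and> p\<^sub>i < p\<^sub>m \<and> p\<^sub>m < p\<^sub>f \<and>
     p\<^sub>m - p\<^sub>i = 2 * D\<^sub>1 \<and> p\<^sub>f - p\<^sub>m = 2 * D\<^sub>2"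

datatype pair_class = Class_I | Class_II | Class_III

fun class_form :: "pair_class \<Rightarrow> int \<Rightarrow> int \<Rightarrow> int \<Rightarrow> int \<Rightarrow> bool" where
  "class_form Class_I D a p p' \<longleftrightarrow>
     odd D \<and> p = 2 * a - D \<and> p' = 2 * a + D"
| "class_form Class_II D a p p' \<longleftrightarrow>
     2 dvd D \<and> \<not> 3 dvd D \<and> p = 3 * (2 * a - 1) - D \<and> p' = 3 * (2 * a - 1) + D"
| "class_form Class_III D a p p' \<longleftrightarrow>
     6 dvd D \<and> D \<ge> 6 \<and> p = 2 * a + 1 - D \<and> p' = 2 * a + 1 + D"

definition pair_in_class :: "pair_class \<Rightarrow> int \<Rightarrow> int \<Rightarrow> int \<Rightarrow> bool" where
  "pair_in_class X D p p' \<longleftrightarrow> odd_prime_pair D p p' \<and> (\<exists>a. class_form X D a p p')"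

definition triplet_class :: "pair_class \<Rightarrow> pair_class \<Rightarrow> (int \<times> int \<times> int) set" where
  "triplet_class X Y = {(p\<^sub>i, p\<^sub>m, p\<^sub>f). \<exists>D\<^sub>1 D\<^sub>2. generalized_triplet D\<^sub>1 D\<^sub>2 p\<^sub>i p\<^sub>m p\<^sub>f \<and>
     pair_in_class X D\<^sub>1 p\<^sub>i p\<^sub>m \<and> pair_in_class Y D\<^sub>2 p\<^sub>m p\<^sub>f}"

end

theory Submission
  imports Defs
begin

text \<open>A class I pair is symmetric about the even centre \<open>2 * a\<close>, a class II pair
  about the odd multiple of three \<open>3 * (2 * b - 1)\<close>. The middle prime is the upper
  member of the first pair and the lower member of the second; equating its two expressions ties
  \<open>a\<close> to \<open>b\<close>, and \<open>centre_relation_iff\<close> identifies this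
  equation with the relation containing the factor 1/2. The outer primes are symmetric about
  \<open>2 * a + D\<^sub>2\<close>, still even, at the odd distance
  \<open>D\<^sub>1 + D\<^sub>2\<close>, which is again class I
  (\<open>outer_pair_in_class_I\<close>). Modulo 6 the centre \<open>2 * a\<close> depends only on
  \<open>a\<close> modulo 3, and the other centre is always -3, so the residues follow by adding and
  subtracting the half-gaps (\<open>class_I_cong_6\<close>, \<open>class_II_cong_6\<close>).\<close>

lemma centre_relation_iff:
  fixes a b D\<^sub>1 D\<^sub>2 :: int
  shows "real_of_int a = 3 * real_of_int b - 1 / 2 * real_of_int (D\<^sub>1 + D\<^sub>2 + 3)
    \<longleftrightarrow> 2 * a + D\<^sub>1 = 3 * (2 * b - 1) - D\<^sub>2" (is "?L \<longleftrightarrow> ?R")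
proof -
  \<comment> \<open>Doubling clears the fraction; both sides are then images of integers, and the
    embedding into the reals is injective.\<close>
  have "?L \<longleftrightarrow> real_of_int (2 * a + D\<^sub>1) = real_of_int (3 * (2 * b - 1) - D\<^sub>2)"
    by (auto simp: field_simps)
  also have "\<dots> \<longleftrightarrow> ?R"
    by (rule of_int_eq_iff)
  finally show ?thesis .
qed

lemma triplet_class_I_II:
  "triplet_class Class_I Class_II =
     {(p\<^sub>i, p\<^sub>m, p\<^sub>f). odd_prime p\<^sub>i \<and> odd_prime p\<^sub>m \<and> odd_prime p\<^sub>f \<and>
        (\<exists>D\<^sub>1 D\<^sub>2 a b :: int.
           odd D\<^sub>1 \<and> 0 < D\<^sub>1 \<and> even D\<^sub>2 \<and> 0 < D\<^sub>2 \<and> \<not> 3 dvd D\<^sub>2 \<and>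
           p\<^sub>i = 2 * a - D\<^sub>1 \<and>
           p\<^sub>m = 2 * a + D\<^sub>1 \<and> p\<^sub>m = 3 * (2 * b - 1) - D\<^sub>2 \<and>
           p\<^sub>f = 3 * (2 * b - 1) + D\<^sub>2)}" (is "_ = ?R")
proof (intro set_eqI iffI)
  fix t assume "t \<in> triplet_class Class_I Class_II"
  then obtain p\<^sub>i p\<^sub>m p\<^sub>f D\<^sub>1 D\<^sub>2 a b where t: "t = (p\<^sub>i, p\<^sub>m, p\<^sub>f)"
    and g: "generalized_triplet D\<^sub>1 D\<^sub>2 p\<^sub>i p\<^sub>m p\<^sub>f"
    and c: "class_form Class_I D\<^sub>1 a p\<^sub>i p\<^sub>m" "class_form Class_II D\<^sub>2 b p\<^sub>m p\<^sub>f"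
    unfolding triplet_class_def pair_in_class_def by blast
  \<comment> \<open>The forms of classes I and II do not give the sign of the half-gaps; it comes
    from the order of the primes.\<close>
  have primes: "odd_prime p\<^sub>i \<and> odd_prime p\<^sub>m \<and> odd_prime p\<^sub>f"
    and pos: "0 < D\<^sub>1 \<and> 0 < D\<^sub>2"
    using g by (auto simp: generalized_triplet_def)
  have "odd D\<^sub>1 \<and> 0 < D\<^sub>1 \<and> even D\<^sub>2 \<and> 0 < D\<^sub>2 \<and> \<not> 3 dvd D\<^sub>2 \<and> p\<^sub>i = 2 * a - D\<^sub>1 \<and>
      p\<^sub>m = 2 * a + D\<^sub>1 \<and> p\<^sub>m = 3 * (2 * b - 1) - D\<^sub>2 \<and> p\<^sub>f = 3 * (2 * b - 1) + D\<^sub>2"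
    using c pos by simp
  with primes show "t \<in> ?R"
    unfolding t by blast
next
  fix t assume "t \<in> ?R"
  then obtain p\<^sub>i p\<^sub>m p\<^sub>f D\<^sub>1 D\<^sub>2 a b where t: "t = (p\<^sub>i, p\<^sub>m, p\<^sub>f)"
    and primes: "odd_prime p\<^sub>i" "odd_prime p\<^sub>m" "odd_prime p\<^sub>f"
    and pos: "0 < D\<^sub>1" "0 < D\<^sub>2"
    and c: "class_form Class_I D\<^sub>1 a p\<^sub>i p\<^sub>m" "class_form Class_II D\<^sub>2 b p\<^sub>m p\<^sub>f"
    by auto
  \<comment> \<open>Subtracting the two expressions in each class form gives the gap, and positive
    half-gaps give the order.\<close>
  have "generalized_triplet D\<^sub>1 D\<^sub>2 p\<^sub>i p\<^sub>m p\<^sub>f" "odd_prime_pair D\<^sub>1 p\<^sub>i p\<^sub>m" "odd_prime_pair D\<^sub>2 p\<^sub>m p\<^sub>f"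
    using primes pos c by (simp_all add: generalized_triplet_def odd_prime_pair_def)
  with c show "t \<in> triplet_class Class_I Class_II"
    unfolding t triplet_class_def pair_in_class_def by blast
qed

lemma outer_pair_in_class_I:
  assumes "generalized_triplet D\<^sub>1 D\<^sub>2 p\<^sub>i p\<^sub>m p\<^sub>f" and "class_form Class_I D\<^sub>1 a p\<^sub>i p\<^sub>m" and "even D\<^sub>2"
  shows "pair_in_class Class_I (D\<^sub>1 + D\<^sub>2) p\<^sub>i p\<^sub>f"
proof -
  \<comment> \<open>The midpoint of the outer pair is \<open>2 * a + D\<^sub>2\<close>, which for
    even \<open>D\<^sub>2\<close> is twice this witness.\<close>
  from assms have "class_form Class_I (D\<^sub>1 + D\<^sub>2) (a + D\<^sub>2 div 2) p\<^sub>i p\<^sub>f"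
    by (auto simp: generalized_triplet_def)
  moreover from assms have "odd_prime_pair (D\<^sub>1 + D\<^sub>2) p\<^sub>i p\<^sub>f"
    by (auto simp: generalized_triplet_def odd_prime_pair_def)
  ultimately show ?thesis
    unfolding pair_in_class_def by blast
qed

text \<open>Doubling lifts a congruence modulo 3 to one modulo 6, so the residue of \<open>a\<close>
  modulo 3 already fixes the centre modulo 6.\<close>

lemma class_I_cong_6:
  assumes "class_form Class_I D a p p'" and "[D = d] (mod 6)" and "[a = a\<^sub>0] (mod 3)"
  shows "[p = 2 * a\<^sub>0 - d] (mod 6)" and "[p' = 2 * a\<^sub>0 + d] (mod 6)"
proof -
  from assms(3) have "[2 * a = 2 * a\<^sub>0] (mod 6)"
    unfolding cong_iff_dvd_diff by presburger
  with assms show "[p = 2 * a\<^sub>0 - d] (mod 6)" and "[p' = 2 * a\<^sub>0 + d] (mod 6)"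
    by (auto intro: cong_add cong_diff)
qed

lemma class_II_cong_6:
  assumes "class_form Class_II D b p p'" and "[D = d] (mod 6)"
  shows "[p = - 3 - d] (mod 6)" and "[p' = - 3 + d] (mod 6)"
proof -
  \<comment> \<open>The centre is \<open>6 * b - 3\<close>, so its residue does not depend on
    \<open>b\<close>.\<close>
  have centre: "[3 * (2 * b - 1) = - 3] (mod 6)"
    by (simp add: cong_iff_dvd_diff)
  show "[p = - 3 - d] (mod 6)" and "[p' = - 3 + d] (mod 6)"
    using cong_diff[OF centre assms(2)] cong_add[OF centre assms(2)] assms(1) by simp_all
qed

theorem corollary2p6:
  "triplet_class Class_I Class_II =
     {(p\<^sub>i, p\<^sub>m, p\<^sub>f). odd_prime p\<^sub>i \<and> odd_prime p\<^sub>m \<and> odd_prime p\<^sub>f \<and>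
        (\<exists>D\<^sub>1 D\<^sub>2 a b :: int.
           odd D\<^sub>1 \<and> 0 < D\<^sub>1 \<and> even D\<^sub>2 \<and> 0 < D\<^sub>2 \<and> \<not> 3 dvd D\<^sub>2 \<and>
           p\<^sub>i = 2 * a - D\<^sub>1 \<and>
           p\<^sub>m = 2 * a + D\<^sub>1 \<and> p\<^sub>m = 3 * (2 * b - 1) - D\<^sub>2 \<and>
           p\<^sub>f = 3 * (2 * b - 1) + D\<^sub>2 \<and>
           real_of_int a = 3 * real_of_int b - 1 / 2 * real_of_int (D\<^sub>1 + D\<^sub>2 + 3))}
   \<and> (\<forall>p\<^sub>i p\<^sub>m p\<^sub>f D\<^sub>1 D\<^sub>2 a b :: int.
        generalized_triplet D\<^sub>1 D\<^sub>2 p\<^sub>i p\<^sub>m p\<^sub>f \<and>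
        class_form Class_I D\<^sub>1 a p\<^sub>i p\<^sub>m \<and> class_form Class_II D\<^sub>2 b p\<^sub>m p\<^sub>f \<longrightarrow>
          real_of_int a = 3 * real_of_int b - 1 / 2 * real_of_int (D\<^sub>1 + D\<^sub>2 + 3) \<and>
          p\<^sub>f = 2 * a + D\<^sub>1 + 2 * D\<^sub>2 \<and>
          p\<^sub>f = 2 * a + D\<^sub>2 + (D\<^sub>1 + D\<^sub>2) \<and>
          p\<^sub>i = 2 * a + D\<^sub>2 - (D\<^sub>1 + D\<^sub>2) \<and>
          pair_in_class Class_I (D\<^sub>1 + D\<^sub>2) p\<^sub>i p\<^sub>f \<and>
          (\<forall>r\<^sub>1 r\<^sub>2 a\<^sub>0 :: int.
             r\<^sub>1 \<in> {0, 1, -1} \<and> [D\<^sub>1 = 2 * r\<^sub>1 + 1] (mod 6) \<and>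
             r\<^sub>2 \<in> {1, -1} \<and> [D\<^sub>2 = 2 * r\<^sub>2] (mod 6) \<and>
             a\<^sub>0 \<in> {0, 1, -1} \<and> [a = a\<^sub>0] (mod 3) \<longrightarrow>
               [p\<^sub>i = - 2 * r\<^sub>1 - 1 + 2 * a\<^sub>0] (mod 6) \<and>
               [p\<^sub>m = 2 * r\<^sub>1 + 1 + 2 * a\<^sub>0] (mod 6) \<and>
               [2 * r\<^sub>1 + 1 + 2 * a\<^sub>0 = - 3 - 2 * r\<^sub>2] (mod 6) \<and>
               [p\<^sub>f = - 3 + 2 * r\<^sub>2] (mod 6)))"
  unfolding centre_relation_iff triplet_class_I_II
proof (intro conjI allI impI; (elim conjE)?)
  fix p\<^sub>i p\<^sub>m p\<^sub>f D\<^sub>1 D\<^sub>2 a b :: int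
  assume g: "generalized_triplet D\<^sub>1 D\<^sub>2 p\<^sub>i p\<^sub>m p\<^sub>f"
    and I: "class_form Class_I D\<^sub>1 a p\<^sub>i p\<^sub>m" and II: "class_form Class_II D\<^sub>2 b p\<^sub>m p\<^sub>f"
  show "2 * a + D\<^sub>1 = 3 * (2 * b - 1) - D\<^sub>2" "p\<^sub>f = 2 * a + D\<^sub>1 + 2 * D\<^sub>2"
    "p\<^sub>f = 2 * a + D\<^sub>2 + (D\<^sub>1 + D\<^sub>2)" "p\<^sub>i = 2 * a + D\<^sub>2 - (D\<^sub>1 + D\<^sub>2)"
    using I II by auto
  show "pair_in_class Class_I (D\<^sub>1 + D\<^sub>2) p\<^sub>i p\<^sub>f"
    using g I II by (intro outer_pair_in_class_I) auto
  fix r\<^sub>1 r\<^sub>2 a\<^sub>0 :: int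
  assume r\<^sub>1: "[D\<^sub>1 = 2 * r\<^sub>1 + 1] (mod 6)" and r\<^sub>2: "[D\<^sub>2 = 2 * r\<^sub>2] (mod 6)" and a: "[a = a\<^sub>0] (mod 3)"
  note cong_I = class_I_cong_6[OF I r\<^sub>1 a] and cong_II = class_II_cong_6[OF II r\<^sub>2]
  show "[p\<^sub>i = - 2 * r\<^sub>1 - 1 + 2 * a\<^sub>0] (mod 6)"
    using cong_I(1) by (simp add: algebra_simps)
  show pm: "[p\<^sub>m = 2 * r\<^sub>1 + 1 + 2 * a\<^sub>0] (mod 6)"
    using cong_I(2) by (simp add: algebra_simps)
  \<comment> \<open>The middle prime has been evaluated in both of its pairs; this congruence
    compares the two results.\<close>
  show "[2 * r\<^sub>1 + 1 + 2 * a\<^sub>0 = - 3 - 2 * r\<^sub>2] (mod 6)"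
    using cong_trans[OF cong_sym[OF pm] cong_II(1)] .
  show "[p\<^sub>f = - 3 + 2 * r\<^sub>2] (mod 6)"
    by (fact cong_II(2))
\<comment> \<open>What remains is the equality of sets. The two descriptions differ only in the
  centre relation, now in integer form, which follows from the two expressions for
  \<open>p\<^sub>m\<close>.\<close>
qed auto

end
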